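(* Let $p$ be a prime and let $R$ be a Noetherian ring containing $\mathbb{F}_p$. If $R$ is F-regular, then it is semi F-regular. If $R$ is semi F-regular, then it is weakly F-regular.
   Context: Rings are commutative with $1$. For a Noetherian ring $R$ of characteristic $p$, $R^\circ$ is the complement of the union of the minimal primes of $R$; the tight closure $I^*$ of an ideal $I$ is the set of $z\in R$ for which there are $c\in R^\circ$ and a power $q_0$ of $p$ with $cz^q\in I^{[q]}$ for all powers $q\ge q_0$ of $p$, where $I^{[q]}$ is the ideal generated by $q$-th powers of elements of $I$. $R$ is weakly F-regular if $I^*=I$ for every ideal $I$ of $R$. $R$ is F-regular if every localization of $R$ at a multiplicative set is weakly F-regular. $R$ is semi F-regular if $R_f$ is weakly F-regular for every $f\in R$; equivalently, for every affine open $U\subseteq\operatorname{Spec}R$, every ideal of $\mathcal{O}_{\operatorname{Spec}R}(U)$ is tightly closed. *)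

theory Defs
  imports "HOL-Number_Theory.Residues" "HOL-Algebra.Ring_Divisibility"
begin

section \<open>Localization of a commutative ring\<close>

definition frac_rel :: "('a, 'm) ring_scheme \<Rightarrow> 'a set \<Rightarrow> (('a \<times> 'a) \<times> ('a \<times> 'a)) set" where
  "frac_rel R S = {((a, s), (b, t)). a \<in> carrier R \<and> s \<in> S \<and> b \<in> carrier R \<and> t \<in> S \<and>
     (\<exists>u\<in>S. u \<otimes>\<^bsub>R\<^esub> (a \<otimes>\<^bsub>R\<^esub> t) = u \<otimes>\<^bsub>R\<^esub> (b \<otimes>\<^bsub>R\<^esub> s))}"

definition fraction :: "('a, 'm) ring_scheme \<Rightarrow> 'a set \<Rightarrow> 'a \<Rightarrow> 'a \<Rightarrow> ('a \<times> 'a) set" where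
  "fraction R S a s = frac_rel R S `` {(a, s)}"

definition localization :: "('a, 'm) ring_scheme \<Rightarrow> 'a set \<Rightarrow> ('a \<times> 'a) set ring" where
  "localization R S =
    \<lparr>carrier = (carrier R \<times> S) // frac_rel R S,
     monoid.mult = \<lambda>X Y. \<Union>(a, s)\<in>X. \<Union>(b, t)\<in>Y. fraction R S (a \<otimes>\<^bsub>R\<^esub> b) (s \<otimes>\<^bsub>R\<^esub> t),
     one = fraction R S \<one>\<^bsub>R\<^esub> \<one>\<^bsub>R\<^esub>,
     zero = fraction R S \<zero>\<^bsub>R\<^esub> \<one>\<^bsub>R\<^esub>,
     add = \<lambda>X Y. \<Union>(a, s)\<in>X. \<Union>(b, t)\<in>Y.
       fraction R S ((a \<otimes>\<^bsub>R\<^esub> t) \<oplus>\<^bsub>R\<^esub> (b \<otimes>\<^bsub>R\<^esub> s)) (s \<otimes>\<^bsub>R\<^esub> t)\<rparr>"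

locale mult_set = cring R + S: submonoid S R for R (structure) and S
begin

lemma S_closed [simp, intro]: "s \<in> S \<Longrightarrow> s \<in> carrier R"
  using S.subset by blast

lemma equiv_frac_rel: "equiv (carrier R \<times> S) (frac_rel R S)"
proof (rule equivI)
  show "frac_rel R S \<subseteq> (carrier R \<times> S) \<times> carrier R \<times> S"
    by (auto simp: frac_rel_def)
  show "refl_on (carrier R \<times> S) (frac_rel R S)"
    using S.one_closed by (auto simp: refl_on_def frac_rel_def)
  show "sym (frac_rel R S)"
    unfolding sym_def frac_rel_def by (auto; metis)
  show "trans (frac_rel R S)"
  proof (rule transI)
    fix x y z assume xy: "(x, y) \<in> frac_rel R S" and yz: "(y, z) \<in> frac_rel R S"
    obtain a s b t c v where e: "x = (a, s)" "y = (b, t)" "z = (c, v)"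
      by (metis surj_pair)
    from xy obtain u where u: "u \<in> S" "u \<otimes> (a \<otimes> t) = u \<otimes> (b \<otimes> s)"
      and c1: "a \<in> carrier R" "s \<in> S" "b \<in> carrier R" "t \<in> S"
      by (auto simp: e frac_rel_def)
    from yz obtain w where w: "w \<in> S" "w \<otimes> (b \<otimes> v) = w \<otimes> (c \<otimes> t)"
      and c2: "c \<in> carrier R" "v \<in> S"
      by (auto simp: e frac_rel_def)
    have "(u \<otimes> w \<otimes> t) \<otimes> (a \<otimes> v) = (w \<otimes> v) \<otimes> (u \<otimes> (a \<otimes> t))"
      using u(1) w(1) c1 c2 by (simp add: m_ac)
    also have "\<dots> = (u \<otimes> s) \<otimes> (w \<otimes> (b \<otimes> v))"
      unfolding u(2) using u(1) w(1) c1 c2 by (simp add: m_ac)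
    also have "\<dots> = (u \<otimes> w \<otimes> t) \<otimes> (c \<otimes> s)"
      unfolding w(2) using u(1) w(1) c1 c2 by (simp add: m_ac)
    finally show "(x, z) \<in> frac_rel R S"
      using u(1) w(1) c1 c2 S.m_closed by (auto simp: e frac_rel_def)
  qed
qed

lemma fraction_eq_iff:
  assumes "a \<in> carrier R" "s \<in> S" "b \<in> carrier R" "t \<in> S"
  shows "fraction R S a s = fraction R S b t \<longleftrightarrow> (\<exists>u\<in>S. u \<otimes> (a \<otimes> t) = u \<otimes> (b \<otimes> s))"
  using eq_equiv_class_iff[OF equiv_frac_rel, of "(a, s)" "(b, t)"] assms
  by (simp add: fraction_def frac_rel_def)

lemma fraction_closed [simp, intro]:
  "a \<in> carrier R \<Longrightarrow> s \<in> S \<Longrightarrow> fraction R S a s \<in> carrier (localization R S)"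
  by (auto simp: localization_def fraction_def intro: quotientI)

lemma localization_cases:
  assumes "X \<in> carrier (localization R S)"
  obtains a s where "a \<in> carrier R" "s \<in> S" "X = fraction R S a s"
  using assms by (auto simp: localization_def fraction_def elim!: quotientE)

lemma UN_fraction:
  assumes "\<And>a s a' s'. \<lbrakk>((a, s), (a', s')) \<in> frac_rel R S\<rbrakk> \<Longrightarrow> f a s = f a' s'"
    and "a \<in> carrier R" "s \<in> S"
  shows "(\<Union>(a, s)\<in>fraction R S a s. f a s) = f a s"
proof -
  have "(\<lambda>(a, s). f a s) respects frac_rel R S"
    using assms(1) by (auto simp: congruent_def)
  from UN_equiv_class[OF equiv_frac_rel this, of "(a, s)"] assms(2,3)
  show ?thesis by (simp add: fraction_def)
qed

lemma mult_fraction [simp]: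
  assumes c: "a \<in> carrier R" "s \<in> S" "b \<in> carrier R" "t \<in> S"
  shows "fraction R S a s \<otimes>\<^bsub>localization R S\<^esub> fraction R S b t = fraction R S (a \<otimes> b) (s \<otimes> t)"
proof -
  have *: "fraction R S (a \<otimes> b) (s \<otimes> t) = fraction R S (a' \<otimes> b) (s' \<otimes> t) \<and>
           fraction R S (b \<otimes> a) (t \<otimes> s) = fraction R S (b \<otimes> a') (t \<otimes> s')"
    if r: "((a, s), (a', s')) \<in> frac_rel R S" and bt: "b \<in> carrier R" "t \<in> S" for a s a' s' b t
  proof -
    from r obtain u where u: "u \<in> S" "u \<otimes> (a \<otimes> s') = u \<otimes> (a' \<otimes> s)"
      and c: "a \<in> carrier R" "s \<in> S" "a' \<in> carrier R" "s' \<in> S"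
      by (auto simp: frac_rel_def)
    have "u \<otimes> ((a \<otimes> b) \<otimes> (s' \<otimes> t)) = (u \<otimes> (a \<otimes> s')) \<otimes> (b \<otimes> t)"
      using u(1) c bt by (simp add: m_ac)
    also have "\<dots> = u \<otimes> ((a' \<otimes> b) \<otimes> (s \<otimes> t))"
      unfolding u(2) using u(1) c bt by (simp add: m_ac)
    finally have "fraction R S (a \<otimes> b) (s \<otimes> t) = fraction R S (a' \<otimes> b) (s' \<otimes> t)"
      using u(1) c bt S.m_closed by (subst fraction_eq_iff) auto
    then show ?thesis
      using c bt by (simp add: m_comm)
  qed
  have inner: "(\<Union>(b, t)\<in>fraction R S b t. fraction R S (a \<otimes> b) (s \<otimes> t)) = fraction R S (a \<otimes> b) (s \<otimes> t)"
    if "a \<in> carrier R" "s \<in> S" for a s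
    by (rule UN_fraction) (use * that c in auto)
  have "(\<Union>(a, s)\<in>fraction R S a s. \<Union>(b, t)\<in>fraction R S b t. fraction R S (a \<otimes> b) (s \<otimes> t))
      = (\<Union>(b, t)\<in>fraction R S b t. fraction R S (a \<otimes> b) (s \<otimes> t))"
  proof (rule UN_fraction)
    fix a s a' s' assume r: "((a, s), (a', s')) \<in> frac_rel R S"
    then have "a \<in> carrier R" "s \<in> S" "a' \<in> carrier R" "s' \<in> S" by (auto simp: frac_rel_def)
    then show "(\<Union>(b, t)\<in>fraction R S b t. fraction R S (a \<otimes> b) (s \<otimes> t))
        = (\<Union>(b, t)\<in>fraction R S b t. fraction R S (a' \<otimes> b) (s' \<otimes> t))"
      using *[OF r c(3,4)] by (simp add: inner)
  qed (use c in auto)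
  then show ?thesis using inner[OF c(1,2)] by (simp add: localization_def)
qed

lemma add_fraction [simp]:
  assumes c: "a \<in> carrier R" "s \<in> S" "b \<in> carrier R" "t \<in> S"
  shows "fraction R S a s \<oplus>\<^bsub>localization R S\<^esub> fraction R S b t
    = fraction R S ((a \<otimes> t) \<oplus> (b \<otimes> s)) (s \<otimes> t)"
proof -
  have *: "fraction R S ((a \<otimes> t) \<oplus> (b \<otimes> s)) (s \<otimes> t) = fraction R S ((a' \<otimes> t) \<oplus> (b \<otimes> s')) (s' \<otimes> t) \<and>
           fraction R S ((b \<otimes> s) \<oplus> (a \<otimes> t)) (t \<otimes> s) = fraction R S ((b \<otimes> s') \<oplus> (a' \<otimes> t)) (t \<otimes> s')"
    if r: "((a, s), (a', s')) \<in> frac_rel R S" and bt: "b \<in> carrier R" "t \<in> S" for a s a' s' b t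
  proof -
    from r obtain u where u: "u \<in> S" "u \<otimes> (a \<otimes> s') = u \<otimes> (a' \<otimes> s)"
      and c: "a \<in> carrier R" "s \<in> S" "a' \<in> carrier R" "s' \<in> S"
      by (auto simp: frac_rel_def)
    have "u \<otimes> (((a \<otimes> t) \<oplus> (b \<otimes> s)) \<otimes> (s' \<otimes> t))
        = (u \<otimes> (a \<otimes> s')) \<otimes> (t \<otimes> t) \<oplus> u \<otimes> (b \<otimes> s \<otimes> s' \<otimes> t)"
      using u(1) c bt by (simp add: m_ac l_distr r_distr)
    also have "\<dots> = u \<otimes> (((a' \<otimes> t) \<oplus> (b \<otimes> s')) \<otimes> (s \<otimes> t))"
      unfolding u(2) using u(1) c bt by (simp add: m_ac l_distr r_distr)
    finally have "fraction R S ((a \<otimes> t) \<oplus> (b \<otimes> s)) (s \<otimes> t)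
        = fraction R S ((a' \<otimes> t) \<oplus> (b \<otimes> s')) (s' \<otimes> t)"
      using u(1) c bt S.m_closed by (subst fraction_eq_iff) auto
    then show ?thesis
      using c bt by (simp add: m_comm a_comm)
  qed
  have inner: "(\<Union>(b, t)\<in>fraction R S b t. fraction R S ((a \<otimes> t) \<oplus> (b \<otimes> s)) (s \<otimes> t))
      = fraction R S ((a \<otimes> t) \<oplus> (b \<otimes> s)) (s \<otimes> t)"
    if "a \<in> carrier R" "s \<in> S" for a s
    by (rule UN_fraction) (use * that c in auto)
  have "(\<Union>(a, s)\<in>fraction R S a s. \<Union>(b, t)\<in>fraction R S b t. fraction R S ((a \<otimes> t) \<oplus> (b \<otimes> s)) (s \<otimes> t))
      = (\<Union>(b, t)\<in>fraction R S b t. fraction R S ((a \<otimes> t) \<oplus> (b \<otimes> s)) (s \<otimes> t))"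
  proof (rule UN_fraction)
    fix a s a' s' assume r: "((a, s), (a', s')) \<in> frac_rel R S"
    then have "a \<in> carrier R" "s \<in> S" "a' \<in> carrier R" "s' \<in> S" by (auto simp: frac_rel_def)
    then show "(\<Union>(b, t)\<in>fraction R S b t. fraction R S ((a \<otimes> t) \<oplus> (b \<otimes> s)) (s \<otimes> t))
        = (\<Union>(b, t)\<in>fraction R S b t. fraction R S ((a' \<otimes> t) \<oplus> (b \<otimes> s')) (s' \<otimes> t))"
      using *[OF r c(3,4)] by (simp add: inner)
  qed (use c in auto)
  then show ?thesis using inner[OF c(1,2)] by (simp add: localization_def)
qed

lemma fraction_eqI:
  assumes "a \<in> carrier R" "s \<in> S" "b \<in> carrier R" "t \<in> S" "a \<otimes> t = b \<otimes> s"
  shows "fraction R S a s = fraction R S b t"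
  using assms S.one_closed by (subst fraction_eq_iff) auto

lemma one_localization: "\<one>\<^bsub>localization R S\<^esub> = fraction R S \<one> \<one>"
  and zero_localization: "\<zero>\<^bsub>localization R S\<^esub> = fraction R S \<zero> \<one>"
  by (simp_all add: localization_def)

theorem cring_localization: "cring (localization R S)"
proof (rule cringI)
  note [simp] = S.m_closed S.one_closed one_localization zero_localization
  show "abelian_group (localization R S)"
  proof (rule abelian_groupI)
    fix X assume "X \<in> carrier (localization R S)"
    then obtain a s where "a \<in> carrier R" "s \<in> S" "X = fraction R S a s"
      by (rule localization_cases)
    then have "fraction R S (\<ominus> a) s \<oplus>\<^bsub>localization R S\<^esub> X = \<zero>\<^bsub>localization R S\<^esub>"
      by (simp add: l_minus l_neg) (rule fraction_eqI; simp)
    with \<open>a \<in> carrier R\<close> \<open>s \<in> S\<close>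
    show "\<exists>Y\<in>carrier (localization R S). Y \<oplus>\<^bsub>localization R S\<^esub> X = \<zero>\<^bsub>localization R S\<^esub>"
      by (meson a_inv_closed fraction_closed)
  qed (auto elim!: localization_cases intro!: fraction_eqI simp: m_ac a_ac l_distr r_distr)
  show "comm_monoid (localization R S)"
    by (rule comm_monoidI) (auto elim!: localization_cases intro!: fraction_eqI simp: m_ac)
qed (elim localization_cases, simp, rule fraction_eqI,
     simp_all add: m_ac a_ac l_distr r_distr)

end

section \<open>Tight closure and F-regularity\<close>

text \<open>The field with p elements embeds into the ring; this excludes the zero ring.\<close>

definition contains_Fp :: "nat \<Rightarrow> ('a, 'm) ring_scheme \<Rightarrow> bool" where
  "contains_Fp p R \<longleftrightarrow>
     (\<exists>h \<in> ring_hom (residue_ring (int p)) R. inj_on h (carrier (residue_ring (int p))))"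

definition minimal_prime :: "'a set \<Rightarrow> ('a, 'm) ring_scheme \<Rightarrow> bool" where
  "minimal_prime P R \<longleftrightarrow> primeideal P R \<and> (\<forall>Q. primeideal Q R \<longrightarrow> Q \<subseteq> P \<longrightarrow> Q = P)"

definition ring_circ :: "('a, 'm) ring_scheme \<Rightarrow> 'a set" where
  "ring_circ R = carrier R - \<Union>{P. minimal_prime P R}"

definition bracket_power :: "('a, 'm) ring_scheme \<Rightarrow> 'a set \<Rightarrow> nat \<Rightarrow> 'a set" where
  "bracket_power R I q = genideal R ((\<lambda>x. x [^]\<^bsub>R\<^esub> q) ` I)"

text \<open>
  The definitions below carry no hypotheses on the ring; they have their usual meaning for
  commutative Noetherian rings of characteristic p (and, for localizations, the zero ring).
  Powers of p include 1.
\<close>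

definition tight_closure :: "nat \<Rightarrow> ('a, 'm) ring_scheme \<Rightarrow> 'a set \<Rightarrow> 'a set" where
  "tight_closure p R I = {z \<in> carrier R. \<exists>c \<in> ring_circ R. \<exists>q0 \<in> range (\<lambda>e::nat. p ^ e).
     \<forall>q \<in> range (\<lambda>e::nat. p ^ e). q0 \<le> q \<longrightarrow>
       c \<otimes>\<^bsub>R\<^esub> (z [^]\<^bsub>R\<^esub> q) \<in> bracket_power R I q}"

definition weakly_F_regular :: "nat \<Rightarrow> ('a, 'm) ring_scheme \<Rightarrow> bool" where
  "weakly_F_regular p R \<longleftrightarrow> (\<forall>I. ideal I R \<longrightarrow> tight_closure p R I = I)"

text \<open>Multiplicative sets are arbitrary submonoids; they may contain zero.\<close>

definition F_regular :: "nat \<Rightarrow> ('a, 'm) ring_scheme \<Rightarrow> bool" where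
  "F_regular p R \<longleftrightarrow> (\<forall>S. submonoid S R \<longrightarrow> weakly_F_regular p (localization R S))"

definition semi_F_regular :: "nat \<Rightarrow> ('a, 'm) ring_scheme \<Rightarrow> bool" where
  "semi_F_regular p R \<longleftrightarrow>
     (\<forall>f \<in> carrier R. weakly_F_regular p (localization R (range (\<lambda>n::nat. f [^]\<^bsub>R\<^esub> n))))"

end

theory Submission
  imports Defs
begin

text \<open>
  Both implications come from choosing the right multiplicative set.  The powers of an element
  \<open>f\<close> form a multiplicative set, so F-regularity, which speaks of all localizations, covers the
  localizations \<open>R\<^sub>f\<close>.  For \<open>f = \<one>\<close> the powers reduce to \<open>{\<one>}\<close>, and the canonical map from \<open>R\<close>
  to the localization at \<open>{\<one>}\<close> is an isomorphism (lemma \<open>localization_at_one_iso\<close>); so the weak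
  F-regularity of \<open>R\<^sub>1\<close> has to be carried back to \<open>R\<close>.

  This transport (lemma \<open>weakly_F_regular_iso\<close>) is the only part that needs an argument.  A
  ring isomorphism \<open>h\<close> respects minimal primes, hence the complement of their union, and it
  respects ideals generated by \<open>q\<close>-th powers; it therefore maps the tight closure of \<open>I\<close> into the
  tight closure of \<open>h ` I\<close>.  If the latter is \<open>h ` I\<close>, injectivity of \<open>h\<close> shows that the tight
  closure of \<open>I\<close> lies in \<open>I\<close>; the reverse inclusion holds for every ideal of every commutative
  ring, with multiplier \<open>c = \<one>\<close>.
\<close>

lemma (in cring) one_in_ring_circ: "\<one> \<in> ring_circ R"
proof -
  have "\<one> \<notin> P" if "primeideal P R" for P
    using that ideal.one_imp_carrier primeideal.I_notcarr primeideal.axioms(1) by metis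
  then show ?thesis
    by (auto simp: ring_circ_def minimal_prime_def)
qed

lemma (in cring) ideal_subset_tight_closure:
  assumes "ideal I R"
  shows "I \<subseteq> tight_closure p R I"
proof
  fix z assume z: "z \<in> I"
  have I: "I \<subseteq> carrier R"
    using assms by (simp add: ideal.axioms(1) additive_subgroup.a_subset)
  have "z [^] q \<in> bracket_power R I q" for q
    using z I genideal_self[of "(\<lambda>x. x [^] q) ` I"] unfolding bracket_power_def by blast
  then have "\<one> \<otimes> z [^] q \<in> bracket_power R I q" for q
    using z I by auto
  then show "z \<in> tight_closure p R I"
    using z I one_in_ring_circ unfolding tight_closure_def by blast
qed

locale ring_isomorphism = R: cring R + S: cring S for R (structure) and S (structure) +
  fixes h
  assumes iso: "h \<in> ring_iso R S"
begin

sublocale ring_hom_ring R S h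
  using iso by unfold_locales (simp add: ring_iso_def)

lemma bij: "bij_betw h (carrier R) (carrier S)"
  using iso by (rule ring_iso_memE(5))

lemma inverse: "ring_isomorphism S R (inv_into (carrier R) h)"
  using ring_iso_set_sym[OF R.ring_axioms iso] by unfold_locales

text \<open>
  Pulling back along the inverse map is the same as pushing forward along \<open>h\<close>; this turns the
  facts on preimages of ideals into facts on images.
\<close>

lemma image_eq_vimage_inverse:
  assumes "I \<subseteq> carrier R"
  shows "h ` I = {s \<in> carrier S. inv_into (carrier R) h s \<in> I}"
proof -
  have "inv_into (carrier R) h (h r) = r" "h r \<in> carrier S" if "r \<in> carrier R" for r
    using that bij by (auto simp: bij_betw_def)
  moreover have "h (inv_into (carrier R) h s) = s" if "s \<in> carrier S" for s
    using that bij by (auto simp: bij_betw_def f_inv_into_f)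
  ultimately show ?thesis
    using assms by (force simp: image_iff subset_iff)
qed

lemma image_ideal:
  assumes "ideal I R"
  shows "ideal (h ` I) S"
proof -
  interpret inv: ring_isomorphism S R "inv_into (carrier R) h"
    by (rule inverse)
  have "I \<subseteq> carrier R"
    using assms by (simp add: ideal.axioms(1) additive_subgroup.a_subset)
  then show ?thesis
    using inv.ideal_vimage[OF assms] by (simp add: image_eq_vimage_inverse)
qed

lemma image_primeideal:
  assumes "primeideal P R"
  shows "primeideal (h ` P) S"
proof -
  interpret inv: ring_isomorphism S R "inv_into (carrier R) h"
    by (rule inverse)
  have "P \<subseteq> carrier R"
    using assms by (simp add: primeideal.axioms(1) ideal.axioms(1) additive_subgroup.a_subset)
  then show ?thesis
    using inv.primeideal_vimage[OF S.cring_axioms assms] by (simp add: image_eq_vimage_inverse)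
qed

text \<open>
  Minimality can be tested on images: a prime \<open>Q\<close> below the preimage of \<open>P\<close> has a prime image
  below \<open>P\<close>, which is \<open>P\<close> by minimality, and \<open>Q\<close> is recovered from its image by injectivity.
\<close>

lemma vimage_minimal_prime:
  assumes "minimal_prime P S"
  shows "minimal_prime {r \<in> carrier R. h r \<in> P} R"
  unfolding minimal_prime_def
proof (intro conjI allI impI)
  show "primeideal {r \<in> carrier R. h r \<in> P} R"
    using assms primeideal_vimage[OF R.cring_axioms] by (simp add: minimal_prime_def)
next
  fix Q assume Q: "primeideal Q R" and sub: "Q \<subseteq> {r \<in> carrier R. h r \<in> P}"
  have "h ` Q \<subseteq> P"
    using sub by blast
  then have eq: "h ` Q = P"
    using assms image_primeideal[OF Q] by (simp add: minimal_prime_def)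
  have "r \<in> Q" if "r \<in> carrier R" "h r \<in> P" for r
  proof -
    have "h r \<in> h ` Q"
      using that eq by simp
    then show ?thesis
      using that sub bij inj_on_image_mem_iff[of h "carrier R" r Q] by (auto simp: bij_betw_def)
  qed
  with sub show "Q = {r \<in> carrier R. h r \<in> P}"
    by blast
qed

lemma ring_circ_image:
  assumes "c \<in> ring_circ R"
  shows "h c \<in> ring_circ S"
  using assms vimage_minimal_prime by (fastforce simp: ring_circ_def)

text \<open>
  The elements sent by \<open>h\<close> into the target ideal form an ideal that contains the generators
  \<open>r\<^sup>q\<close> with \<open>r \<in> I\<close>, hence all of the ideal they generate.
\<close>

lemma bracket_power_image:
  assumes I: "I \<subseteq> carrier R" and x: "x \<in> bracket_power R I q"
  shows "h x \<in> bracket_power S (h ` I) q"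
proof -
  let ?J = "bracket_power S (h ` I) q"
  have pow: "(\<lambda>y. y [^]\<^bsub>S\<^esub> q) ` h ` I \<subseteq> carrier S"
    using I by auto
  have "ideal {r \<in> carrier R. h r \<in> ?J} R"
    unfolding bracket_power_def by (intro ideal_vimage S.genideal_ideal pow)
  moreover have "(\<lambda>r. r [^] q) ` I \<subseteq> {r \<in> carrier R. h r \<in> ?J}"
  proof (rule image_subsetI)
    fix r assume r: "r \<in> I"
    then have rR: "r \<in> carrier R"
      using I by blast
    have "h r [^]\<^bsub>S\<^esub> q \<in> ?J"
      using r S.genideal_self[OF pow] unfolding bracket_power_def by blast
    then show "r [^] q \<in> {r \<in> carrier R. h r \<in> ?J}"
      using rR hom_nat_pow[OF rR] by simp
  qed
  ultimately show ?thesis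
    using x R.genideal_minimal unfolding bracket_power_def by blast
qed

lemma tight_closure_image:
  assumes I: "I \<subseteq> carrier R" and z: "z \<in> tight_closure p R I"
  shows "h z \<in> tight_closure p S (h ` I)"
proof -
  obtain c q0 where zR: "z \<in> carrier R" and c: "c \<in> ring_circ R"
    and q0: "q0 \<in> range (\<lambda>e::nat. p ^ e)"
    and mem: "\<And>q. q \<in> range (\<lambda>e::nat. p ^ e) \<Longrightarrow> q0 \<le> q \<Longrightarrow> c \<otimes> z [^] q \<in> bracket_power R I q"
    using z unfolding tight_closure_def by blast
  have cR: "c \<in> carrier R"
    using c by (simp add: ring_circ_def)
  have "h c \<otimes>\<^bsub>S\<^esub> h z [^]\<^bsub>S\<^esub> q \<in> bracket_power S (h ` I) q"
    if "q \<in> range (\<lambda>e::nat. p ^ e)" "q0 \<le> q" for q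
    using bracket_power_image[OF I mem[OF that]] zR cR hom_nat_pow[OF zR] by simp
  then show ?thesis
    unfolding tight_closure_def using hom_closed[OF zR]
    by (intro CollectI conjI bexI[OF _ ring_circ_image[OF c]] bexI[OF _ q0] ballI impI)
qed

theorem weakly_F_regular_iso:
  assumes "weakly_F_regular p S"
  shows "weakly_F_regular p R"
  unfolding weakly_F_regular_def
proof (intro allI impI equalityI)
  fix I assume I: "ideal I R"
  then have sub: "I \<subseteq> carrier R"
    by (simp add: ideal.axioms(1) additive_subgroup.a_subset)
  show "I \<subseteq> tight_closure p R I"
    using I by (rule R.ideal_subset_tight_closure)
  show "tight_closure p R I \<subseteq> I"
  proof
    fix z assume z: "z \<in> tight_closure p R I"
    then have "h z \<in> h ` I"
      using tight_closure_image[OF sub z] assms image_ideal[OF I]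
      by (simp add: weakly_F_regular_def)
    moreover have "z \<in> carrier R"
      using z by (simp add: tight_closure_def)
    ultimately show "z \<in> I"
      using sub bij inj_on_image_mem_iff[of h "carrier R" z I] by (auto simp: bij_betw_def)
  qed
qed

end

lemma (in monoid) submonoid_powers:
  assumes "f \<in> carrier G"
  shows "submonoid (range (\<lambda>n::nat. f [^] n)) G"
proof
  show "\<one> \<in> range (\<lambda>n::nat. f [^] n)"
    by (rule range_eqI[of _ _ 0]) simp
qed (use assms in \<open>auto simp: nat_pow_mult\<close>)

text \<open>
  With \<open>\<one>\<close> as the only denominator, every fraction is of the form \<open>a / \<one>\<close>, and \<open>a / \<one> = b / \<one>\<close>
  forces \<open>a = b\<close>, since \<open>\<one>\<close> is also the only factor allowed in the comparison of fractions.
\<close>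

lemma (in cring) localization_at_one_iso:
  "(\<lambda>x. fraction R {\<one>} x \<one>) \<in> ring_iso R (localization R {\<one>})"
proof -
  interpret L: mult_set R "{\<one>}"
    by unfold_locales auto
  show ?thesis
  proof (rule ring_iso_memI)
    have "inj_on (\<lambda>x. fraction R {\<one>} x \<one>) (carrier R)"
      by (rule inj_onI) (simp add: L.fraction_eq_iff)
    moreover have "(\<lambda>x. fraction R {\<one>} x \<one>) ` carrier R = carrier (localization R {\<one>})"
    proof
      show "carrier (localization R {\<one>}) \<subseteq> (\<lambda>x. fraction R {\<one>} x \<one>) ` carrier R"
      proof
        fix X assume "X \<in> carrier (localization R {\<one>})"
        then obtain a s where "a \<in> carrier R" "s \<in> {\<one>}" "X = fraction R {\<one>} a s"
          by (rule L.localization_cases)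
        then show "X \<in> (\<lambda>x. fraction R {\<one>} x \<one>) ` carrier R"
          by simp
      qed
    qed auto
    ultimately show "bij_betw (\<lambda>x. fraction R {\<one>} x \<one>) (carrier R) (carrier (localization R {\<one>}))"
      by (simp add: bij_betw_def)
  qed (auto simp: L.one_localization)
qed

theorem proposition4p18:
  fixes R :: "('a, 'm) ring_scheme" and p :: nat
  assumes "Factorial_Ring.prime p"
    and "cring R" and "noetherian_ring R" and "contains_Fp p R"
  shows "(F_regular p R \<longrightarrow> semi_F_regular p R) \<and>
         (semi_F_regular p R \<longrightarrow> weakly_F_regular p R)"
proof (intro conjI impI)
  interpret cring R by fact
  show "semi_F_regular p R" if "F_regular p R"
    using that submonoid_powers by (simp add: F_regular_def semi_F_regular_def)
  show "weakly_F_regular p R" if "semi_F_regular p R"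
  proof -
    have "range (\<lambda>n::nat. \<one>\<^bsub>R\<^esub> [^]\<^bsub>R\<^esub> n) = {\<one>\<^bsub>R\<^esub>}"
      by auto
    then have L: "weakly_F_regular p (localization R {\<one>\<^bsub>R\<^esub>})"
      using that one_closed unfolding semi_F_regular_def by metis
    interpret mult_set R "{\<one>\<^bsub>R\<^esub>}"
      by unfold_locales auto
    interpret L: cring "localization R {\<one>\<^bsub>R\<^esub>}"
      by (rule cring_localization)
    interpret ring_isomorphism R "localization R {\<one>\<^bsub>R\<^esub>}" "\<lambda>x. fraction R {\<one>\<^bsub>R\<^esub>} x \<one>\<^bsub>R\<^esub>"
      by unfold_locales (rule localization_at_one_iso)
    show ?thesis
      using L by (rule weakly_F_regular_iso)
  qed
qed

end
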